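(* Let $E$ and $F$ be quasi-Banach function lattices over measure spaces $(\Omega,\mu)$ and $(\widetilde\Omega,\nu)$, respectively, let $T:E\to F$ be a bounded linear operator, and let $\kappa\ge 1$ be the smallest constant such that $\|f+g\|_F\le\kappa(\|f\|_F+\|g\|_F)$ for all $f,g\in F$. Let $\mathcal A$ be a filtration of $\Omega$ and let $T^{*}$ be the maximal operator based on $T$ associated to $\mathcal A$. Assume that $F$ has the Fatou property. If there exist $p,q$ such that $0<p<q\le\infty$ and $\ell u<(1+\kappa^{-\tau})^{1/\tau}$, where $\ell=\ell_{(p),2}(E)$, $u=u^{(q),2}(F)$ and $\frac1\tau=\frac1p-\frac1q$, then $\|T^{*}\|_{E\to F}\le\gamma\|T\|_{E\to F}$, with \[ \gamma=\frac{u(1+\kappa^{-\tau})^{1/q}}{\kappa^{-\tau/p}-(\ell^pu^p(1+\kappa^{-\tau})^{p/q}-1)^{1/p}}. \] If $F$ is a Banach space, then \[ \gamma=\frac{u2^{1/q}}{1-(\ell^pu^p2^{p/q}-1)^{1/p}}. \]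
   Context: Measure spaces are complete and $\sigma$-finite; $L^0_\mu$ is the space of (equivalence classes of) real- or complex-valued measurable functions finite $\mu$-a.e. A quasi-norm satisfies the axioms of a norm except that the triangle inequality is replaced by $\|x+y\|\le\kappa(\|x\|+\|y\|)$ for some $\kappa\ge1$; a complete quasi-normed space is a quasi-Banach space. A quasi-Banach space $E\subset L^0_\mu$ is a quasi-Banach function lattice over $\Omega$ if $f\in E$, $g\in L^0_\mu$, $|g|\le|f|$ a.e. imply $g\in E$ and $\|g\|_E\le\|f\|_E$. For a quasi-Banach function lattice $X$, $0<p\le\infty$, $n\in\mathbb N$: $u^{(p),n}(X)$ is the least $C$ such that $\|\sum_{j=1}^n x_j\|_X\le C(\sum_{j=1}^n\|x_j\|_X^p)^{1/p}$ for all disjointly supported $x_1,\dots,x_n\in X$; $\ell_{(p),n}(X)$ is the least $C$ such that $(\sum_{j=1}^n\|x_j\|_X^p)^{1/p}\le C\|\sum_{j=1}^n x_j\|_X$ for all disjointly supported $x_1,\dots,x_n\in X$ (with $\max_j\|x_j\|_X$ in place of the $p$-sum when $p=\infty$). Convention: $1/\infty=0$. $F$ has the Fatou property if for every measurable $f$: whenever $0\le f_j\in F$ $(j\in\mathbb N)$ increases to $f$ pointwise a.e., then $f\in F$ and $\|f_j\|_F\to\|f\|_F$. A filtration of $\Omega$ is a family $\mathcal A=\{A_\alpha:\alpha\in Q\}$ of measurable subsets of $\Omega$ indexed by a countable totally ordered set $Q$ such that $\alpha<\alpha'$ implies $A_\alpha\subset A_{\alpha'}$. The maximal operator based on $T$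 associated to $\mathcal A$ is $T^*f=\sup_{\alpha\in Q}|T(f\chi_{A_\alpha})|$, $f\in E$. $\|T^*\|_{E\to F}$ is the least $C$ with $\|T^*f\|_F\le C\|f\|_E$ for all $f\in E$. *)

theory Defs
  imports "HOL-Analysis.Analysis"
begin

text \<open>
  Elements of \<open>L\<^sup>0\<close> are represented by everywhere finite measurable functions, and a space of
  equivalence classes by a set of functions that is closed under almost everywhere equality
  (see \<open>lattice\<close> below).  The scalar field is a type \<open>'k\<close> of sort
  \<open>{real_normed_field, euclidean_space}\<close>: by the Gelfand-Mazur theorem these are \<open>real\<close> and
  \<open>complex\<close>, up to isomorphism.
\<close>

definition quasi_norm_on ::
    "'a measure \<Rightarrow> ('a \<Rightarrow> 'k::real_normed_field) set \<Rightarrow> (('a \<Rightarrow> 'k) \<Rightarrow> real) \<Rightarrow> bool" where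
  "quasi_norm_on M E nE \<longleftrightarrow>
     (\<forall>f\<in>E. 0 \<le> nE f) \<and>
     (\<forall>f\<in>E. nE f = 0 \<longleftrightarrow> (AE x in M. f x = 0)) \<and>
     (\<forall>c. \<forall>f\<in>E. nE (\<lambda>x. c * f x) = norm c * nE f) \<and>
     (\<exists>\<kappa>\<ge>1. \<forall>f\<in>E. \<forall>g\<in>E. nE (\<lambda>x. f x + g x) \<le> \<kappa> * (nE f + nE g))"

definition complete_quasi_norm_on ::
    "('a \<Rightarrow> 'k::real_normed_field) set \<Rightarrow> (('a \<Rightarrow> 'k) \<Rightarrow> real) \<Rightarrow> bool" where
  "complete_quasi_norm_on E nE \<longleftrightarrow>
     (\<forall>f :: nat \<Rightarrow> 'a \<Rightarrow> 'k.
        (\<forall>n. f n \<in> E) \<and>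
        (\<forall>e>0. \<exists>N. \<forall>m\<ge>N. \<forall>n\<ge>N. nE (\<lambda>x. f m x - f n x) < e) \<longrightarrow>
        (\<exists>g\<in>E. (\<lambda>n. nE (\<lambda>x. f n x - g x)) \<longlonglongrightarrow> 0))"

locale quasi_banach_function_lattice = sigma_finite_measure M + complete_measure M
  for M :: "'a measure" +
  fixes E :: "('a \<Rightarrow> 'k::{real_normed_field, euclidean_space}) set"
    and nE :: "('a \<Rightarrow> 'k) \<Rightarrow> real"
  assumes subset_L0: "E \<subseteq> borel_measurable M"
    and zero_mem: "(\<lambda>x. 0) \<in> E"
    and add_mem: "\<lbrakk>f \<in> E; g \<in> E\<rbrakk> \<Longrightarrow> (\<lambda>x. f x + g x) \<in> E"
    and scale_mem: "f \<in> E \<Longrightarrow> (\<lambda>x. c * f x) \<in> E"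
    and quasi_norm: "quasi_norm_on M E nE"
    and complete_quasi_norm: "complete_quasi_norm_on E nE"
    and lattice: "\<lbrakk>f \<in> E; g \<in> borel_measurable M; AE x in M. norm (g x) \<le> norm (f x)\<rbrakk>
                    \<Longrightarrow> g \<in> E \<and> nE g \<le> nE f"

definition triangle_const :: "('a \<Rightarrow> 'k::real_normed_field) set \<Rightarrow> (('a \<Rightarrow> 'k) \<Rightarrow> real) \<Rightarrow> real" where
  "triangle_const E nE =
     Inf {\<kappa>. 1 \<le> \<kappa> \<and> (\<forall>f\<in>E. \<forall>g\<in>E. nE (\<lambda>x. f x + g x) \<le> \<kappa> * (nE f + nE g))}"

text \<open>A quasi-Banach space is a Banach space if its quasi-norm is a norm.\<close>

definition triangle_inequality_on ::
    "('a \<Rightarrow> 'k::real_normed_field) set \<Rightarrow> (('a \<Rightarrow> 'k) \<Rightarrow> real) \<Rightarrow> bool" where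
  "triangle_inequality_on E nE \<longleftrightarrow> (\<forall>f\<in>E. \<forall>g\<in>E. nE (\<lambda>x. f x + g x) \<le> nE f + nE g)"

definition disjointly_supported ::
    "'a measure \<Rightarrow> nat set \<Rightarrow> (nat \<Rightarrow> 'a \<Rightarrow> 'k::real_normed_field) \<Rightarrow> bool" where
  "disjointly_supported M J x \<longleftrightarrow>
     (\<forall>i\<in>J. \<forall>j\<in>J. i \<noteq> j \<longrightarrow> (AE t in M. x i t = 0 \<or> x j t = 0))"

definition p_sum :: "ennreal \<Rightarrow> nat \<Rightarrow> (nat \<Rightarrow> real) \<Rightarrow> real" where
  "p_sum p n a =
     (if p = \<infinity> then Max (a ` {1..n})
      else (\<Sum>j=1..n. a j powr enn2real p) powr (1 / enn2real p))"

text \<open>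
  In a quasi-Banach function lattice, for \<open>n \<ge> 1\<close> and \<open>p > 0\<close>, the infima in the next two
  definitions are finite and attained: \<open>upper_const M E nE p n\<close> is \<open>u\<^sup>(\<^sup>p\<^sup>)\<^sup>,\<^sup>n(E)\<close> and
  \<open>lower_const M E nE p n\<close> is \<open>\<ell>\<^sub>(\<^sub>p\<^sub>)\<^sub>,\<^sub>n(E)\<close>.
\<close>

definition upper_const ::
    "'a measure \<Rightarrow> ('a \<Rightarrow> 'k::real_normed_field) set \<Rightarrow> (('a \<Rightarrow> 'k) \<Rightarrow> real) \<Rightarrow> ennreal \<Rightarrow> nat \<Rightarrow> real" where
  "upper_const M E nE p n =
     Inf {C. 0 \<le> C \<and>
       (\<forall>x. (\<forall>j\<in>{1..n}. x j \<in> E) \<and> disjointly_supported M {1..n} x \<longrightarrow>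
          nE (\<lambda>t. \<Sum>j=1..n. x j t) \<le> C * p_sum p n (\<lambda>j. nE (x j)))}"

definition lower_const ::
    "'a measure \<Rightarrow> ('a \<Rightarrow> 'k::real_normed_field) set \<Rightarrow> (('a \<Rightarrow> 'k) \<Rightarrow> real) \<Rightarrow> ennreal \<Rightarrow> nat \<Rightarrow> real" where
  "lower_const M E nE p n =
     Inf {C. 0 \<le> C \<and>
       (\<forall>x. (\<forall>j\<in>{1..n}. x j \<in> E) \<and> disjointly_supported M {1..n} x \<longrightarrow>
          p_sum p n (\<lambda>j. nE (x j)) \<le> C * nE (\<lambda>t. \<Sum>j=1..n. x j t))}"

text \<open>
  The limit \<open>f\<close> is required to belong to the space only if the quasi-norms of the \<open>f\<^sub>j\<close> are bounded
  (equivalently, the quasi-norm is read as \<open>\<infinity>\<close> outside the space).  Without this clause not even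
  \<open>L\<^sup>1\<close> over the real line would have the property; the lemma below records that the version
  without it is the more restrictive one.
\<close>

definition fatou_property ::
    "'a measure \<Rightarrow> ('a \<Rightarrow> 'k::real_normed_field) set \<Rightarrow> (('a \<Rightarrow> 'k) \<Rightarrow> real) \<Rightarrow> bool" where
  "fatou_property M F nF \<longleftrightarrow>
     (\<forall>(f :: 'a \<Rightarrow> real) (g :: nat \<Rightarrow> 'a \<Rightarrow> real).
        f \<in> borel_measurable M \<and>
        (\<forall>j. (\<lambda>x. of_real (g j x)) \<in> F) \<and>
        (AE x in M. (\<forall>j. 0 \<le> g j x) \<and> incseq (\<lambda>j. g j x) \<and> (\<lambda>j. g j x) \<longlonglongrightarrow> f x) \<and>
        bdd_above (range (\<lambda>j. nF (\<lambda>x. of_real (g j x)))) \<longrightarrow>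
        (\<lambda>x. of_real (f x)) \<in> F \<and>
        (\<lambda>j. nF (\<lambda>x. of_real (g j x))) \<longlonglongrightarrow> nF (\<lambda>x. of_real (f x)))"

lemma fatou_propertyI_without_bound:
  fixes F :: "('a \<Rightarrow> 'k::real_normed_field) set"
  assumes "\<And>(f :: 'a \<Rightarrow> real) (g :: nat \<Rightarrow> 'a \<Rightarrow> real).
      \<lbrakk>f \<in> borel_measurable M; \<And>j. (\<lambda>x. of_real (g j x)) \<in> F;
       AE x in M. (\<forall>j. 0 \<le> g j x) \<and> incseq (\<lambda>j. g j x) \<and> (\<lambda>j. g j x) \<longlonglongrightarrow> f x\<rbrakk>
      \<Longrightarrow> (\<lambda>x. of_real (f x)) \<in> F \<and>
          (\<lambda>j. nF (\<lambda>x. of_real (g j x))) \<longlonglongrightarrow> nF (\<lambda>x. of_real (f x))"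
  shows "fatou_property M F nF"
  unfolding fatou_property_def using assms by blast

text \<open>Linearity and well-definedness on equivalence classes are almost everywhere statements.\<close>

definition bounded_linear_operator ::
    "'a measure \<Rightarrow> ('a \<Rightarrow> 'k::real_normed_field) set \<Rightarrow> (('a \<Rightarrow> 'k) \<Rightarrow> real) \<Rightarrow>
     'b measure \<Rightarrow> ('b \<Rightarrow> 'k) set \<Rightarrow> (('b \<Rightarrow> 'k) \<Rightarrow> real) \<Rightarrow>
     (('a \<Rightarrow> 'k) \<Rightarrow> 'b \<Rightarrow> 'k) \<Rightarrow> bool" where
  "bounded_linear_operator M E nE N F nF T \<longleftrightarrow>
     (\<forall>f\<in>E. T f \<in> F) \<and>
     (\<forall>f\<in>E. \<forall>g\<in>E. (AE x in M. f x = g x) \<longrightarrow> (AE y in N. T f y = T g y)) \<and>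
     (\<forall>f\<in>E. \<forall>g\<in>E. AE y in N. T (\<lambda>x. f x + g x) y = T f y + T g y) \<and>
     (\<forall>c. \<forall>f\<in>E. AE y in N. T (\<lambda>x. c * f x) y = c * T f y) \<and>
     (\<exists>C. \<forall>f\<in>E. nF (T f) \<le> C * nE f)"

definition operator_norm ::
    "('a \<Rightarrow> 'k::real_normed_field) set \<Rightarrow> (('a \<Rightarrow> 'k) \<Rightarrow> real) \<Rightarrow> (('b \<Rightarrow> 'k) \<Rightarrow> real) \<Rightarrow>
     (('a \<Rightarrow> 'k) \<Rightarrow> 'b \<Rightarrow> 'k) \<Rightarrow> real" where
  "operator_norm E nE nF T = Inf {C. 0 \<le> C \<and> (\<forall>f\<in>E. nF (T f) \<le> C * nE f)}"

definition filtration :: "'a measure \<Rightarrow> 'i::linorder set \<Rightarrow> ('i \<Rightarrow> 'a set) \<Rightarrow> bool" where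
  "filtration M Q A \<longleftrightarrow>
     countable Q \<and> (\<forall>\<alpha>\<in>Q. A \<alpha> \<in> sets M) \<and>
     (\<forall>\<alpha>\<in>Q. \<forall>\<alpha>'\<in>Q. \<alpha> < \<alpha>' \<longrightarrow> A \<alpha> \<subseteq> A \<alpha>')"

text \<open>
  A priori the supremum may be infinite, so the maximal operator takes values in \<^typ>\<open>ennreal\<close>.
  Such a function belongs to \<open>F\<close> if it is finite almost everywhere and its finite representative
  lies in \<open>F\<close>; otherwise its quasi-norm is \<open>\<infinity>\<close>.
\<close>

definition maximal_operator ::
    "'i set \<Rightarrow> ('i \<Rightarrow> 'a set) \<Rightarrow> (('a \<Rightarrow> 'k::real_normed_field) \<Rightarrow> 'b \<Rightarrow> 'k) \<Rightarrow>
     ('a \<Rightarrow> 'k) \<Rightarrow> 'b \<Rightarrow> ennreal" where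
  "maximal_operator Q A T f y =
     (SUP \<alpha>\<in>Q. ennreal (norm (T (\<lambda>x. indicator (A \<alpha>) x * f x) y)))"

definition extended_quasi_norm ::
    "'b measure \<Rightarrow> ('b \<Rightarrow> 'k::real_normed_field) set \<Rightarrow> (('b \<Rightarrow> 'k) \<Rightarrow> real) \<Rightarrow>
     ('b \<Rightarrow> ennreal) \<Rightarrow> ennreal" where
  "extended_quasi_norm N F nF g =
     (if (AE y in N. g y < \<infinity>) \<and> (\<lambda>y. of_real (enn2real (g y))) \<in> F
      then ennreal (nF (\<lambda>y. of_real (enn2real (g y)))) else \<infinity>)"

definition extended_operator_norm ::
    "('a \<Rightarrow> 'k::real_normed_field) set \<Rightarrow> (('a \<Rightarrow> 'k) \<Rightarrow> real) \<Rightarrow>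
     'b measure \<Rightarrow> ('b \<Rightarrow> 'k) set \<Rightarrow> (('b \<Rightarrow> 'k) \<Rightarrow> real) \<Rightarrow>
     (('a \<Rightarrow> 'k) \<Rightarrow> 'b \<Rightarrow> ennreal) \<Rightarrow> ennreal" where
  "extended_operator_norm E nE N F nF S =
     Inf {C. \<forall>f\<in>E. extended_quasi_norm N F nF (S f) \<le> C * ennreal (nE f)}"

text \<open>The real number \<open>1/q\<close> for \<open>0 < q \<le> \<infinity>\<close>, with \<open>1/\<infinity> = 0\<close>.\<close>

definition recip :: "ennreal \<Rightarrow> real" where
  "recip q = enn2real (1 / q)"

end

theory Submission
  imports Defs
begin

text \<open>
  This is the method of Christ and Kiselev, with the point at which the function is cut placed
  asymmetrically.  By the Fatou property it is enough to bound the maximal operator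
  \<open>T\<^sub>S f = max\<^bsub>\<alpha>\<in>S\<^esub> |T (f \<chi>\<^bsub>A \<alpha>\<^esub>)|\<close> of a finite subfamily \<open>S\<close> of the filtration by
  \<open>\<gamma> \<parallel>T\<parallel> \<parallel>f\<parallel>\<close>, uniformly in \<open>S\<close>.  This is done by induction on the cardinality of \<open>S\<close>.

  Fix a number \<open>a > 0\<close> and let \<open>k\<close> be the first index of \<open>S\<close> at which
  \<open>\<parallel>f \<chi>\<^bsub>A k\<^esub>\<parallel> > a \<parallel>f\<parallel>\<close>, or the last index if there is no such index.  The indices before \<open>k\<close>
  only see a part of \<open>f\<close> of quasi-norm at most \<open>a \<parallel>f\<parallel>\<close>.  The index \<open>k\<close> and those after it see
  \<open>f \<chi>\<^bsub>A k\<^esub>\<close>, on which \<open>T\<close> itself acts, plus a piece of the remainder of \<open>f\<close> off \<open>A k\<close>.  If indices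
  after \<open>k\<close> exist, then \<open>f \<chi>\<^bsub>A k\<^esub>\<close> is large, and the lower \<open>p\<close>-estimate makes the remainder small,
  of quasi-norm at most \<open>b \<parallel>f\<parallel>\<close> with \<open>b = (l\<^sup>p - a\<^sup>p)\<^bsup>1/p\<^esup>\<close>.  Pointwise, \<open>T\<^sub>S f\<close> is at most the
  maximum of the two contributions (\<open>finite_maximal_split\<close>), and this maximum is a sum of two
  disjointly supported functions, since each point belongs to the larger contribution.  The upper
  \<open>q\<close>-estimate and the induction hypothesis give
  \<open>\<parallel>T\<^sub>S f\<parallel> \<le> u ((\<gamma> a)\<^sup>q + \<kappa>\<^sup>q (1 + \<gamma> b)\<^sup>q)\<^bsup>1/q\<^esup> \<parallel>T\<parallel> \<parallel>f\<parallel>\<close>, to be read as a maximum if \<open>q = \<infinity>\<close>.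
  The constant \<open>\<gamma>\<close> reproduces itself if the two contributions are balanced so that
  \<open>\<kappa> (1 + \<gamma> b) = \<gamma> a \<kappa>\<^bsup>-\<tau>/q\<^esup>\<close> and \<open>u a (1 + \<kappa>\<^bsup>-\<tau>\<^esup>)\<^bsup>1/q\<^esup> = 1\<close>.  The second equation
  determines \<open>a\<close> and the first one then yields the asserted formula for \<open>\<gamma>\<close>
  (\<open>Christ_Kiselev_constants\<close>).  Unless \<open>T\<close> vanishes, \<open>l\<close> and \<open>u\<close> are at least \<open>1\<close>, and the hypothesis
  on \<open>l u\<close> then says precisely that the denominator is positive.  The induction itself is
  \<open>norm_finite_maximal_le\<close>.

  In the passage to the whole filtration (\<open>fatou_extended\<close>) the supremum is not known beforehand to be
  finite almost everywhere.  Each multiple \<open>m \<chi>\<^sub>Z\<close> of the characteristic function of the set \<open>Z\<close> where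
  it is infinite is an increasing limit of functions dominated by the finite maxima, so all these
  multiples have quasi-norms below one common bound; this forces \<open>Z\<close> to be a null set.
\<close>

section \<open>Extremal constants and two-term sums\<close>

text \<open>
  An infimum of admissible constants is itself admissible, because each of the inequalities
  \<open>h x \<le> C * g x\<close> is closed in \<open>C\<close>.  The triangle constant, the operator norm and the upper and lower
  constants all have this form.
\<close>

lemma Inf_bound_attained:
  fixes h g :: "'c \<Rightarrow> real" and m :: real
  assumes nonneg: "\<And>x. P x \<Longrightarrow> 0 \<le> g x"
    and C: "m \<le> C" "\<And>x. P x \<Longrightarrow> h x \<le> C * g x"
  defines "c \<equiv> Inf {C. m \<le> C \<and> (\<forall>x. P x \<longrightarrow> h x \<le> C * g x)}"
  shows "m \<le> c" and "\<And>x. P x \<Longrightarrow> h x \<le> c * g x"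
proof -
  let ?S = "{C. m \<le> C \<and> (\<forall>x. P x \<longrightarrow> h x \<le> C * g x)}"
  have ne: "?S \<noteq> {}" using C by blast
  show "m \<le> c" unfolding c_def by (rule cInf_greatest[OF ne]) auto
  show "h x \<le> c * g x" if x: "P x" for x
  proof (cases "g x = 0")
    case True
    then show ?thesis using C(2)[OF x] by simp
  next
    case False
    then have g: "0 < g x" using nonneg[OF x] by simp
    have "h x / g x \<le> c" unfolding c_def
      by (rule cInf_greatest[OF ne]) (use g x in \<open>auto simp: pos_divide_le_eq\<close>)
    then show ?thesis using g by (simp add: pos_divide_le_eq)
  qed
qed

lemma p_sum_2:
  "p_sum q 2 a = (if q = \<infinity> then max (a 1) (a 2)
     else (a 1 powr enn2real q + a 2 powr enn2real q) powr (1 / enn2real q))"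
proof -
  have "{1..2::nat} = {1, 2}" by auto
  then show ?thesis by (simp add: p_sum_def)
qed

lemma enn2real_exponent_pos: "0 < q \<Longrightarrow> q \<noteq> \<infinity> \<Longrightarrow> 0 < enn2real q"
  by (simp add: enn2real_positive_iff less_top)

lemma recip_eq:
  assumes "0 < q" "q \<noteq> \<infinity>"
  shows "recip q = 1 / enn2real q"
  using assms unfolding recip_def
  by (cases q) (auto simp: divide_ennreal ennreal_1[symmetric] simp del: ennreal_1)

lemma p_sum_2_bounds:
  assumes q: "0 < q" and a: "0 \<le> a 1" "0 \<le> a 2"
  shows "a 1 \<le> p_sum q 2 a" "a 2 \<le> p_sum q 2 a"
    and "p_sum q 2 a \<le> 2 powr recip q * max (a 1) (a 2)"
proof -
  have *: "a 1 \<le> p_sum q 2 a \<and> a 2 \<le> p_sum q 2 a \<and> p_sum q 2 a \<le> 2 powr recip q * max (a 1) (a 2)"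
  proof (cases "q = \<infinity>")
    case True
    then show ?thesis by (simp add: p_sum_2 recip_def)
  next
    case False
    define s where "s = enn2real q"
    have s: "0 < s" unfolding s_def by (rule enn2real_exponent_pos[OF q False])
    have r: "recip q = 1 / s" unfolding s_def by (rule recip_eq[OF q False])
    have pw: "x \<le> (x powr s + y powr s) powr (1 / s)" "y \<le> (x powr s + y powr s) powr (1 / s)"
      if "0 \<le> x" "0 \<le> y" for x y
    proof -
      have "(x powr s) powr (1 / s) \<le> (x powr s + y powr s) powr (1 / s)"
        "(y powr s) powr (1 / s) \<le> (x powr s + y powr s) powr (1 / s)"
        using s by (auto intro!: powr_mono2)
      then show "x \<le> (x powr s + y powr s) powr (1 / s)" "y \<le> (x powr s + y powr s) powr (1 / s)"
        using s that by (simp_all add: powr_powr)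
    qed
    have "(a 1 powr s + a 2 powr s) powr (1 / s) \<le> (2 * max (a 1) (a 2) powr s) powr (1 / s)"
    proof (rule powr_mono2)
      have "a 1 powr s \<le> max (a 1) (a 2) powr s" "a 2 powr s \<le> max (a 1) (a 2) powr s"
        using s a by (auto intro!: powr_mono2)
      then show "a 1 powr s + a 2 powr s \<le> 2 * max (a 1) (a 2) powr s" by simp
    qed (use s in auto)
    also have "\<dots> = 2 powr (1 / s) * max (a 1) (a 2)"
      using s a by (simp add: powr_mult powr_powr)
    finally show ?thesis using False pw[OF a] by (simp add: p_sum_2 r flip: s_def)
  qed
  then show "a 1 \<le> p_sum q 2 a" "a 2 \<le> p_sum q 2 a"
    "p_sum q 2 a \<le> 2 powr recip q * max (a 1) (a 2)" by auto
qed

text \<open>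
  The weight \<open>K\<^bsup>1/q\<^esup>\<close> becomes \<open>1\<close> for \<open>q = \<infinity>\<close>, so that finite and infinite exponents obey
  the same bound.
\<close>

lemma p_sum_2_weighted:
  assumes q: "0 < q" and a: "0 \<le> a 1" "0 \<le> a 2" and X: "0 \<le> X" and K: "0 < K"
    and a1: "a 1 \<le> X" and a2: "a 2 \<le> X * K powr recip q"
  shows "p_sum q 2 a \<le> X * (1 + K) powr recip q"
proof (cases "q = \<infinity>")
  case True
  then show ?thesis using a1 a2 K by (simp add: p_sum_2 recip_def)
next
  case False
  define s where "s = enn2real q"
  have s: "0 < s" unfolding s_def by (rule enn2real_exponent_pos[OF q False])
  have r: "recip q = 1 / s" unfolding s_def by (rule recip_eq[OF q False])
  have "(a 1 powr s + a 2 powr s) powr (1 / s) \<le> (X powr s * (1 + K)) powr (1 / s)"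
  proof (rule powr_mono2)
    have "a 1 powr s \<le> X powr s" using s a a1 by (auto intro!: powr_mono2)
    moreover have "a 2 powr s \<le> (X * K powr (1 / s)) powr s"
      using s a a2 r by (auto intro!: powr_mono2)
    moreover have "(X * K powr (1 / s)) powr s = X powr s * K"
      using s X K by (simp add: powr_mult powr_powr)
    ultimately show "a 1 powr s + a 2 powr s \<le> X powr s * (1 + K)" by (simp add: algebra_simps)
  qed (use s in auto)
  also have "\<dots> = X * (1 + K) powr (1 / s)"
    using s X K by (simp add: powr_mult powr_powr)
  finally show ?thesis using False by (simp add: p_sum_2 r flip: s_def)
qed

section \<open>The balance of the constants\<close>

text \<open>
  With \<open>K = \<kappa>\<^bsup>-\<tau>\<^esup>\<close>, \<open>w = u (1 + K)\<^sup>r\<close> and \<open>a = 1/w\<close>, the number \<open>b\<close> equals \<open>c/w\<close>, where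
  \<open>c = ((l w)\<^sup>p - 1)\<^bsup>1/p\<^esup>\<close> is the root in the denominator \<open>D = \<kappa>\<^bsup>-\<tau>/p\<^esup> - c\<close> of \<open>\<gamma> = w/D\<close>.  Hence
  \<open>1 + \<gamma> b = 1 + c/D = \<kappa>\<^bsup>-\<tau>/p\<^esup>/D\<close>, and the balance equation follows from
  \<open>1 - \<tau>/p = -\<tau> r\<close>.
\<close>

lemma Christ_Kiselev_constants:
  fixes p \<tau> \<kappa> l u r \<gamma> :: real
  assumes p: "0 < p" and \<tau>: "0 < \<tau>" "1 / \<tau> = 1 / p - r"
    and \<kappa>: "1 \<le> \<kappa>" and l: "1 \<le> l" and u: "1 \<le> u" and r: "0 \<le> r"
    and small: "l * u < (1 + \<kappa> powr (- \<tau>)) powr (1 / \<tau>)"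
    and \<gamma>: "\<gamma> = u * (1 + \<kappa> powr (- \<tau>)) powr r /
               (\<kappa> powr (- \<tau> / p) -
                 (l powr p * u powr p * (1 + \<kappa> powr (- \<tau>)) powr (p * r) - 1) powr (1 / p))"
    and a: "a = 1 / (u * (1 + \<kappa> powr (- \<tau>)) powr r)"
    and b: "b = (l powr p - a powr p) powr (1 / p)"
  shows "0 < a" "0 \<le> \<gamma>" "u * a * (1 + \<kappa> powr (- \<tau>)) powr r = 1"
    and "\<kappa> * (1 + \<gamma> * b) = \<gamma> * a * (\<kappa> powr (- \<tau>)) powr r"
proof -
  define K where "K = \<kappa> powr (- \<tau>)"
  define w where "w = u * (1 + K) powr r"
  define c where "c = ((l * w) powr p - 1) powr (1 / p)"
  define D where "D = \<kappa> powr (- \<tau> / p) - c"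
  have K: "0 < K" unfolding K_def using \<kappa> by simp
  have "1 \<le> (1 + K) powr r" using K r by (simp add: ge_one_powr_ge_zero)
  then have w: "1 \<le> w" unfolding w_def using u mult_mono[of 1 u 1 "(1 + K) powr r"] by simp
  have lw: "1 \<le> l * w" using l w mult_mono[of 1 l 1 w] by simp
  have aw: "a = 1 / w" unfolding a w_def K_def ..
  have lwp: "l powr p * u powr p * (1 + K) powr (p * r) = (l * w) powr p"
    unfolding w_def using l u K by (simp add: powr_mult powr_powr mult.commute)
  then have \<gamma>D: "\<gamma> = w / D" unfolding \<gamma> D_def c_def w_def K_def by simp
  \<comment> \<open>The smallness of \<open>l * u\<close> amounts to \<open>(l * w)\<^sup>p < 1 + K\<close>, hence to \<open>c < K\<^bsup>1/p\<^esup>\<close>.\<close>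
  have "l * w < (1 + K) powr (1 / \<tau>) * (1 + K) powr r"
    unfolding w_def using small K unfolding K_def[symmetric]
    by (simp flip: mult.assoc)
  also have "\<dots> = (1 + K) powr (1 / p)" using \<tau>(2) by (simp flip: powr_add)
  finally have "(l * w) powr p < ((1 + K) powr (1 / p)) powr p"
    using p lw by (intro powr_less_mono2) auto
  then have "(l * w) powr p - 1 < K" using p K by (simp add: powr_powr)
  moreover have ge: "0 \<le> (l * w) powr p - 1" using lw p by (simp add: ge_one_powr_ge_zero)
  ultimately have "c < K powr (1 / p)"
    unfolding c_def using p by (intro powr_less_mono2) auto
  also have "K powr (1 / p) = \<kappa> powr (- \<tau> / p)" unfolding K_def by (simp add: powr_powr)
  finally have D: "0 < D" unfolding D_def by simp
  show "0 < a" using aw w by simp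
  show "0 \<le> \<gamma>" using \<gamma>D D w by simp
  show "u * a * (1 + \<kappa> powr (- \<tau>)) powr r = 1"
    using aw w unfolding K_def[symmetric] by (simp add: mult.commute[of u a] mult.assoc flip: w_def)
  have "l powr p - a powr p = ((l * w) powr p - 1) / w powr p"
    using l w by (simp add: aw powr_mult powr_divide field_simps)
  then have "b = c / w"
    unfolding b c_def using w p ge by (simp add: powr_divide powr_powr)
  then have "\<gamma> * b = c / D" using \<gamma>D w by simp
  moreover have "\<kappa> powr (- \<tau> / p) = D + c" by (simp add: D_def)
  ultimately have "1 + \<gamma> * b = \<kappa> powr (- \<tau> / p) / D"
    using D by (simp add: add_divide_distrib)
  moreover have "\<kappa> * \<kappa> powr (- \<tau> / p) = (\<kappa> powr (- \<tau>)) powr r"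
  proof -
    have "1 - \<tau> / p = - \<tau> * r" using \<tau> by (simp add: field_simps)
    moreover have "\<kappa> * \<kappa> powr (- \<tau> / p) = \<kappa> powr (1 + - \<tau> / p)"
      using \<kappa> by (simp only: powr_add) simp
    ultimately show ?thesis by (simp add: powr_powr)
  qed
  ultimately show "\<kappa> * (1 + \<gamma> * b) = \<gamma> * a * (\<kappa> powr (- \<tau>)) powr r"
    using \<gamma>D aw w by (simp add: field_simps)
qed

text \<open>
  The lower \<open>p\<close>-estimate reads \<open>t\<^sup>p + s\<^sup>p \<le> (l n)\<^sup>p\<close>: if the part \<open>t\<close> exceeds \<open>a n\<close>, then
  only \<open>(l\<^sup>p - a\<^sup>p) n\<^sup>p\<close> is left for the other part.
\<close>

lemma remainder_bound:
  fixes a l n p s t :: real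
  assumes p: "0 < p" and nonneg: "0 \<le> a" "0 \<le> l" "0 \<le> s" "0 \<le> n" "s \<le> n"
    and large: "a * n < t"
    and split: "(t powr p + s powr p) powr (1 / p) \<le> l * n"
  shows "s \<le> (l powr p - a powr p) powr (1 / p) * n"
proof (cases "n = 0")
  case True
  then show ?thesis using nonneg by simp
next
  case False
  then have n: "0 < n" using nonneg by simp
  have "((t powr p + s powr p) powr (1 / p)) powr p \<le> (l * n) powr p"
    using split p by (intro powr_mono2) auto
  then have "t powr p + s powr p \<le> l powr p * n powr p"
    using p nonneg by (simp add: powr_powr powr_mult)
  moreover have "(a * n) powr p \<le> t powr p"
    using large p nonneg by (intro powr_mono2) auto
  ultimately have s: "s powr p \<le> (l powr p - a powr p) * n powr p"
    using nonneg by (simp add: powr_mult algebra_simps)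
  then have "0 \<le> (l powr p - a powr p) * n powr p"
    by (rule order_trans[rotated]) simp
  then have "0 \<le> l powr p - a powr p" using n by (simp add: zero_le_mult_iff)
  then have "((l powr p - a powr p) * n powr p) powr (1 / p) = (l powr p - a powr p) powr (1 / p) * n"
    using p n by (simp add: powr_mult powr_powr)
  moreover have "(s powr p) powr (1 / p) \<le> ((l powr p - a powr p) * n powr p) powr (1 / p)"
    using s p by (intro powr_mono2) auto
  ultimately show ?thesis using p nonneg by (simp add: powr_powr)
qed

section \<open>Quasi-Banach function lattices\<close>

context quasi_banach_function_lattice
begin

lemma nE_nonneg: "f \<in> E \<Longrightarrow> 0 \<le> nE f"
  using quasi_norm by (simp add: quasi_norm_on_def)

lemma nE_eq_0_iff: "f \<in> E \<Longrightarrow> nE f = 0 \<longleftrightarrow> (AE x in M. f x = 0)"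
  using quasi_norm by (simp add: quasi_norm_on_def)

lemma nE_scale: "f \<in> E \<Longrightarrow> nE (\<lambda>x. c * f x) = norm c * nE f"
  using quasi_norm by (simp add: quasi_norm_on_def)

lemma measurable_mem: "f \<in> E \<Longrightarrow> f \<in> borel_measurable M"
  using subset_L0 by blast

lemma of_real_measurable:
  "g \<in> borel_measurable M \<Longrightarrow> (\<lambda>x. of_real (g x) :: 'k) \<in> borel_measurable M"
  by (rule borel_measurable_continuous_on[of of_real]) (auto intro: continuous_intros)

lemma of_real_measurableD:
  assumes "(\<lambda>x. of_real (g x) :: 'k) \<in> E" "\<And>x. 0 \<le> g x"
  shows "g \<in> borel_measurable M"
proof -
  have "(\<lambda>x. norm (of_real (g x) :: 'k)) \<in> borel_measurable M"
    using measurable_mem[OF assms(1)] by measurable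
  then show ?thesis using assms(2) by simp
qed

lemma restrict_mem:
  assumes "f \<in> E" and B: "B \<inter> space M \<in> sets M"
  shows "(\<lambda>x. indicator B x * f x) \<in> E" "nE (\<lambda>x. indicator B x * f x) \<le> nE f"
proof -
  have "(\<lambda>x. indicator (B \<inter> space M) x * f x) \<in> borel_measurable M"
    using measurable_mem[OF assms(1)] B by measurable
  then have "(\<lambda>x. indicator B x * f x) \<in> borel_measurable M"
    by (rule measurable_cong[THEN iffD1, rotated]) (simp add: indicator_def)
  then show "(\<lambda>x. indicator B x * f x) \<in> E" "nE (\<lambda>x. indicator B x * f x) \<le> nE f"
    using lattice[OF assms(1)] by (auto simp: indicator_def)
qed

lemma modulus_mem:
  assumes "f \<in> E"
  shows "(\<lambda>x. of_real (norm (f x))) \<in> E" "nE (\<lambda>x. of_real (norm (f x))) \<le> nE f"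
proof -
  have "(\<lambda>x. of_real (norm (f x)) :: 'k) \<in> borel_measurable M"
    using measurable_mem[OF assms] by (intro of_real_measurable) measurable
  then show "(\<lambda>x. of_real (norm (f x))) \<in> E" "nE (\<lambda>x. of_real (norm (f x))) \<le> nE f"
    using lattice[OF assms] by auto
qed

lemma triangle_const_attained:
  shows triangle_const_ge_1: "1 \<le> triangle_const E nE"
    and quasi_triangle:
      "\<lbrakk>f \<in> E; g \<in> E\<rbrakk> \<Longrightarrow> nE (\<lambda>x. f x + g x) \<le> triangle_const E nE * (nE f + nE g)"
proof -
  obtain C where C: "1 \<le> C" "\<And>f g. f \<in> E \<Longrightarrow> g \<in> E \<Longrightarrow> nE (\<lambda>x. f x + g x) \<le> C * (nE f + nE g)"
    using quasi_norm unfolding quasi_norm_on_def by blast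
  let ?P = "\<lambda>z. fst z \<in> E \<and> snd z \<in> E"
  have eq: "triangle_const E nE = Inf {C. 1 \<le> C \<and>
      (\<forall>z. ?P z \<longrightarrow> nE (\<lambda>x. fst z x + snd z x) \<le> C * (nE (fst z) + nE (snd z)))}"
    unfolding triangle_const_def by (intro arg_cong[where f = Inf]) auto
  note attained = Inf_bound_attained[where P = ?P and m = 1 and C = C
      and h = "\<lambda>z. nE (\<lambda>x. fst z x + snd z x)" and g = "\<lambda>z. nE (fst z) + nE (snd z)",
      folded eq]
  show "1 \<le> triangle_const E nE"
    by (rule attained(1)) (use C nE_nonneg in auto)
  show "nE (\<lambda>x. f x + g x) \<le> triangle_const E nE * (nE f + nE g)" if "f \<in> E" "g \<in> E"
    using attained(2)[of "(f, g)"] C nE_nonneg that by force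
qed

lemma triangle_const_eq_1:
  assumes "triangle_inequality_on E nE"
  shows "triangle_const E nE = 1"
proof (rule antisym[OF _ triangle_const_ge_1])
  show "triangle_const E nE \<le> 1"
    unfolding triangle_const_def
    by (rule cInf_lower) (use assms in \<open>auto simp: triangle_inequality_on_def intro: bdd_belowI[of _ 1]\<close>)
qed

text \<open>
  The quasi-triangle inequality makes \<open>2 \<kappa>\<close> an admissible upper constant, and the lattice property
  makes \<open>2\<^bsup>1/p\<^esup>\<close> an admissible lower one; so the two infima are over nonempty sets.
\<close>

lemma upper_const_attained:
  assumes q: "0 < q"
  shows upper_const_nonneg: "0 \<le> upper_const M E nE q 2"
    and upper_const_bound: "\<lbrakk>x 1 \<in> E; x 2 \<in> E; AE t in M. x 1 t = 0 \<or> x 2 t = 0\<rbrakk> \<Longrightarrow>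
      nE (\<lambda>t. x 1 t + x 2 t) \<le> upper_const M E nE q 2 * p_sum q 2 (\<lambda>j. nE (x j))"
proof -
  let ?\<kappa> = "triangle_const E nE"
  let ?P = "\<lambda>x. (\<forall>j\<in>{1..2}. x j \<in> E) \<and> disjointly_supported M {1..2} x"
  have two: "{1..2::nat} = {1, 2}" "{Suc 0..2} = {1, 2}" by auto
  have mem: "x 1 \<in> E" "x 2 \<in> E" if "?P x" for x using that by auto
  note nn = mem[THEN nE_nonneg]
  note ps = p_sum_2_bounds[OF q, of "\<lambda>j. nE (x j)" for x]
  note attained = Inf_bound_attained[where P = ?P and m = 0 and C = "2 * ?\<kappa>"
      and h = "\<lambda>x. nE (\<lambda>t. \<Sum>j=1..2. x j t)" and g = "\<lambda>x. p_sum q 2 (\<lambda>j. nE (x j))",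
      folded upper_const_def]
  have ps0: "0 \<le> p_sum q 2 (\<lambda>j. nE (x j))" if "?P x" for x
    using ps(1)[of x] nn[OF that] by linarith
  have bound: "nE (\<lambda>t. \<Sum>j=1..2. x j t) \<le> 2 * ?\<kappa> * p_sum q 2 (\<lambda>j. nE (x j))" if "?P x" for x
  proof -
    have "nE (\<lambda>t. x 1 t + x 2 t) \<le> ?\<kappa> * (nE (x 1) + nE (x 2))"
      using mem[OF that] by (intro quasi_triangle)
    also have "\<dots> \<le> ?\<kappa> * (2 * p_sum q 2 (\<lambda>j. nE (x j)))"
      using ps(1,2)[of x] nn[OF that] triangle_const_ge_1 by (intro mult_left_mono) auto
    finally show ?thesis by (simp add: two algebra_simps)
  qed
  have k: "0 \<le> 2 * ?\<kappa>" using triangle_const_ge_1 by simp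
  show "0 \<le> upper_const M E nE q 2"
    by (rule attained(1)) (erule ps0 | erule bound | rule k)+
  assume x: "x 1 \<in> E" "x 2 \<in> E" "AE t in M. x 1 t = 0 \<or> x 2 t = 0"
  have "AE t in M. x 2 t = 0 \<or> x 1 t = 0" using x(3) by (rule AE_mp) auto
  then have P: "?P x" using x unfolding two by (auto simp: disjointly_supported_def)
  have "nE (\<lambda>t. \<Sum>j=1..2. x j t) \<le> upper_const M E nE q 2 * p_sum q 2 (\<lambda>j. nE (x j))"
    by (rule attained(2)) (erule ps0 | erule bound | rule k | rule P)+
  then show "nE (\<lambda>t. x 1 t + x 2 t) \<le> upper_const M E nE q 2 * p_sum q 2 (\<lambda>j. nE (x j))"
    by (simp add: two)
qed

lemma lower_const_attained:
  assumes p: "0 < p"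
  shows lower_const_nonneg: "0 \<le> lower_const M E nE p 2"
    and lower_const_bound: "\<lbrakk>x 1 \<in> E; x 2 \<in> E; AE t in M. x 1 t = 0 \<or> x 2 t = 0\<rbrakk> \<Longrightarrow>
      p_sum p 2 (\<lambda>j. nE (x j)) \<le> lower_const M E nE p 2 * nE (\<lambda>t. x 1 t + x 2 t)"
proof -
  let ?P = "\<lambda>x. (\<forall>j\<in>{1..2}. x j \<in> E) \<and> disjointly_supported M {1..2} x"
  have two: "{1..2::nat} = {1, 2}" "{Suc 0..2} = {1, 2}" by auto
  have mem: "x 1 \<in> E" "x 2 \<in> E" if "?P x" for x using that by auto
  note attained = Inf_bound_attained[where P = ?P and m = 0 and C = "2 powr recip p"
      and g = "\<lambda>x. nE (\<lambda>t. \<Sum>j=1..2. x j t)" and h = "\<lambda>x. p_sum p 2 (\<lambda>j. nE (x j))",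
      folded lower_const_def]
  have g0: "0 \<le> nE (\<lambda>t. \<Sum>j=1..2. x j t)" if "?P x" for x
    using add_mem[OF mem[OF that]] by (simp add: two nE_nonneg)
  have bound: "p_sum p 2 (\<lambda>j. nE (x j)) \<le> 2 powr recip p * nE (\<lambda>t. \<Sum>j=1..2. x j t)" if "?P x" for x
  proof -
    have E: "(\<lambda>t. x 1 t + x 2 t) \<in> E" by (rule add_mem[OF mem[OF that]])
    have ae: "AE t in M. x 1 t = 0 \<or> x 2 t = 0"
      using that by (auto simp: disjointly_supported_def)
    have "nE (x 1) \<le> nE (\<lambda>t. x 1 t + x 2 t)" "nE (x 2) \<le> nE (\<lambda>t. x 1 t + x 2 t)"
      using ae by (auto intro!: lattice[OF E measurable_mem, THEN conjunct2] mem[OF that]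
          simp del: One_nat_def)
    then have "2 powr recip p * max (nE (x 1)) (nE (x 2)) \<le> 2 powr recip p * nE (\<lambda>t. x 1 t + x 2 t)"
      by (intro mult_left_mono) auto
    moreover have "p_sum p 2 (\<lambda>j. nE (x j)) \<le> 2 powr recip p * max (nE (x 1)) (nE (x 2))"
      using p_sum_2_bounds(3)[OF p, of "\<lambda>j. nE (x j)"] mem[OF that, THEN nE_nonneg] by simp
    ultimately have "p_sum p 2 (\<lambda>j. nE (x j)) \<le> 2 powr recip p * nE (\<lambda>t. x 1 t + x 2 t)"
      by (rule order_trans[rotated])
    then show ?thesis by (simp add: two)
  qed
  have k: "0 \<le> 2 powr recip p" by simp
  show "0 \<le> lower_const M E nE p 2"
    by (rule attained(1)) (erule g0 | erule bound | rule k)+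
  assume x: "x 1 \<in> E" "x 2 \<in> E" "AE t in M. x 1 t = 0 \<or> x 2 t = 0"
  have "AE t in M. x 2 t = 0 \<or> x 1 t = 0" using x(3) by (rule AE_mp) auto
  then have P: "?P x" using x unfolding two by (auto simp: disjointly_supported_def)
  have "p_sum p 2 (\<lambda>j. nE (x j)) \<le> lower_const M E nE p 2 * nE (\<lambda>t. \<Sum>j=1..2. x j t)"
    by (rule attained(2)) (erule g0 | erule bound | rule k | rule P)+
  then show "p_sum p 2 (\<lambda>j. nE (x j)) \<le> lower_const M E nE p 2 * nE (\<lambda>t. x 1 t + x 2 t)"
    by (simp add: two)
qed

text \<open>
  Test the defining inequalities on the disjoint pair consisting of \<open>f\<close> and \<open>0\<close>.
\<close>

lemma constants_ge_1:
  assumes f: "f \<in> E" "nE f \<noteq> 0"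
  shows upper_const_ge_1: "0 < q \<Longrightarrow> 1 \<le> upper_const M E nE q 2"
    and lower_const_ge_1: "0 < q \<Longrightarrow> 1 \<le> lower_const M E nE q 2"
proof -
  define x :: "nat \<Rightarrow> 'a \<Rightarrow> 'k" where "x = (\<lambda>j. if j = 1 then f else (\<lambda>_. 0))"
  have x: "x 1 = f" "x 2 = (\<lambda>_. 0)" by (simp_all add: x_def)
  have z: "nE (\<lambda>_. 0) = 0" using nE_eq_0_iff[OF zero_mem] by simp
  have n: "0 < nE f" using f nE_nonneg[of f] by simp
  have ps: "p_sum q 2 (\<lambda>j. nE (x j)) = nE f" if q: "0 < q"
    using n enn2real_exponent_pos[OF q]
    by (auto simp: p_sum_2 x[unfolded One_nat_def] z powr_powr)
  show "1 \<le> upper_const M E nE q 2" if "0 < q"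
    using upper_const_bound[OF that, of x] f zero_mem n ps[OF that] 
    by (simp add: x[unfolded One_nat_def])
  show "1 \<le> lower_const M E nE q 2" if "0 < q"
    using lower_const_bound[OF that, of x] f zero_mem n ps[OF that] 
    by (simp add: x[unfolded One_nat_def])
qed

text \<open>
  The Fatou property concerns limits that are finite everywhere.  To apply it to a supremum that may
  be infinite, one first uses it on the truncations \<open>min (g n) (m \<chi>\<^sub>Z)\<close>, whose limit \<open>m \<chi>\<^sub>Z\<close> is
  finite, to see that the set \<open>Z\<close> of infinite values is null.
\<close>

lemma fatou_extended:
  assumes fatou: "fatou_property M E nE"
    and g: "\<And>n. (\<lambda>x. of_real (g n x)) \<in> E" "\<And>n x. 0 \<le> g n x" "\<And>x. incseq (\<lambda>n. g n x)"
    and C: "\<And>n. nE (\<lambda>x. of_real (g n x)) \<le> C"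
  shows "extended_quasi_norm M E nE (\<lambda>x. SUP n. ennreal (g n x)) \<le> ennreal C"
proof -
  let ?G = "\<lambda>x. SUP n. ennreal (g n x)"
  have gm[measurable]: "g n \<in> borel_measurable M" for n
    using of_real_measurableD g by blast
  have limit: "(\<lambda>x. of_real (h x)) \<in> E \<and> nE (\<lambda>x. of_real (h x)) \<le> C"
    if h: "h \<in> borel_measurable M" "\<And>n. (\<lambda>x. of_real (k n x)) \<in> E"
      "AE x in M. (\<forall>n. 0 \<le> k n x) \<and> incseq (\<lambda>n. k n x) \<and> (\<lambda>n. k n x) \<longlonglongrightarrow> h x"
      "\<And>n. nE (\<lambda>x. of_real (k n x)) \<le> C" for h k
  proof -
    have "bdd_above (range (\<lambda>n. nE (\<lambda>x. of_real (k n x))))"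
      using h(4) by (auto intro!: bdd_aboveI2)
    then have "(\<lambda>x. of_real (h x)) \<in> E \<and>
        (\<lambda>n. nE (\<lambda>x. of_real (k n x))) \<longlonglongrightarrow> nE (\<lambda>x. of_real (h x))"
      using fatou h unfolding fatou_property_def by blast
    then show ?thesis using h(4) by (auto intro: LIMSEQ_le_const2)
  qed
  define Z where "Z = {x \<in> space M. ?G x = \<infinity>}"
  have Z[measurable]: "Z \<in> sets M" unfolding Z_def by measurable
  have Zm: "(\<lambda>x. of_real (real m * indicator Z x)) \<in> E \<and>
      nE (\<lambda>x. of_real (real m * indicator Z x)) \<le> C" for m
  proof (rule limit[where k = "\<lambda>n x. min (g n x) (real m * indicator Z x)"])
    show "(\<lambda>x. of_real (min (g n x) (real m * indicator Z x))) \<in> E"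
      "nE (\<lambda>x. of_real (min (g n x) (real m * indicator Z x))) \<le> C" for n
    proof -
      have "(\<lambda>x. of_real (min (g n x) (real m * indicator Z x)) :: 'k) \<in> borel_measurable M"
        by (intro of_real_measurable) measurable
      note l = lattice[OF g(1)[of n] this]
      have "AE x in M. norm (of_real (min (g n x) (real m * indicator Z x)) :: 'k)
          \<le> norm (of_real (g n x) :: 'k)"
        using g(2) by (auto simp: indicator_def min_def)
      with l C[of n] show "(\<lambda>x. of_real (min (g n x) (real m * indicator Z x))) \<in> E"
        "nE (\<lambda>x. of_real (min (g n x) (real m * indicator Z x))) \<le> C" by force+
    qed
    show "AE x in M. (\<forall>n. 0 \<le> min (g n x) (real m * indicator Z x)) \<and>
        incseq (\<lambda>n. min (g n x) (real m * indicator Z x)) \<and>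
        (\<lambda>n. min (g n x) (real m * indicator Z x)) \<longlonglongrightarrow> real m * indicator Z x"
    proof (rule AE_I2, intro conjI allI)
      fix x assume "x \<in> space M"
      show "0 \<le> min (g n x) (real m * indicator Z x)" for n using g(2) by simp
      show "incseq (\<lambda>n. min (g n x) (real m * indicator Z x))"
        using g(3)[of x] by (fastforce simp: incseq_def min_def)
      show "(\<lambda>n. min (g n x) (real m * indicator Z x)) \<longlonglongrightarrow> real m * indicator Z x"
      proof (cases "x \<in> Z")
        case False
        then show ?thesis using g(2) by (simp add: min_absorb2)
      next
        case True
        then have "?G x = top" unfolding Z_def infinity_ennreal_def by blast
          then have "ennreal (real m) < ?G x" by (simp only: ennreal_less_top)
        then obtain n where "ennreal (real m) < ennreal (g n x)" unfolding less_SUP_iff by blast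
        then have "real m \<le> g n x" using g(2) by (simp add: ennreal_less_iff)
        then have "real m \<le> g i x" if "n \<le> i" for i
          using incseqD[OF g(3)[of x] that] by simp
        then have "\<forall>\<^sub>F i in sequentially. min (g i x) (real m * indicator Z x) = real m * indicator Z x"
          unfolding eventually_sequentially using True by (auto intro!: exI[of _ n] simp: min_absorb2)
        then show ?thesis by (rule tendsto_eventually)
      qed
    qed
  qed simp
  have chi: "(\<lambda>x. of_real (indicator Z x)) \<in> E" using Zm[of 1] by simp
  have "real m * nE (\<lambda>x. of_real (indicator Z x)) \<le> C" for m
    using Zm[of m] nE_scale[OF chi, of "of_nat m"] by simp
  then have "nE (\<lambda>x. of_real (indicator Z x)) \<le> 0"
    by (meson ex_less_of_nat_mult not_le)
  then have "nE (\<lambda>x. of_real (indicator Z x)) = 0" using nE_nonneg[OF chi] by simp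
  then have "AE x in M. (of_real (indicator Z x) :: 'k) = 0" using nE_eq_0_iff[OF chi] by simp
  then have "AE x in M. x \<notin> Z" by eventually_elim (auto simp: indicator_def)
  moreover have "AE x in M. x \<in> space M" by simp
  ultimately have fin: "AE x in M. ?G x < \<infinity>"
  proof eventually_elim
    case (elim x)
    then have "?G x \<noteq> \<infinity>" unfolding Z_def by blast
    then show ?case by (simp only: infinity_ennreal_def less_top)
  qed
  have "(\<lambda>x. of_real (enn2real (?G x))) \<in> E \<and> nE (\<lambda>x. of_real (enn2real (?G x))) \<le> C"
  proof (rule limit[OF _ g(1) _ C])
    show "(\<lambda>x. enn2real (?G x)) \<in> borel_measurable M" by measurable
    show "AE x in M. (\<forall>n. 0 \<le> g n x) \<and> incseq (\<lambda>n. g n x) \<and> (\<lambda>n. g n x) \<longlonglongrightarrow> enn2real (?G x)"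
      using fin
    proof eventually_elim
      case (elim x)
      have "(\<lambda>n. ennreal (g n x)) \<longlonglongrightarrow> ?G x"
        using g(3)[of x] by (intro LIMSEQ_SUP) (auto simp: incseq_def intro: ennreal_leI)
      then have "(\<lambda>n. enn2real (ennreal (g n x))) \<longlonglongrightarrow> enn2real (?G x)"
        using elim by (intro tendsto_enn2real) auto
      then show ?case using g(2,3) by simp
    qed
  qed
  then show ?thesis
    using fin unfolding extended_quasi_norm_def by (auto intro: ennreal_leI)
qed

end


section \<open>Maximal operators of finite subfamilies\<close>

locale filtered_operator =
  dom: quasi_banach_function_lattice M E nE + cod: quasi_banach_function_lattice N F nF
  for M :: "'a measure" and E :: "('a \<Rightarrow> 'k::{real_normed_field, euclidean_space}) set" and nE
    and N :: "'b measure" and F :: "('b \<Rightarrow> 'k) set" and nF +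
  fixes T :: "('a \<Rightarrow> 'k) \<Rightarrow> 'b \<Rightarrow> 'k"
    and Q :: "'i::linorder set" and A :: "'i \<Rightarrow> 'a set"
  assumes bounded: "bounded_linear_operator M E nE N F nF T"
    and filtered: "filtration M Q A"
begin

lemma T_mem: "f \<in> E \<Longrightarrow> T f \<in> F"
  using bounded by (simp add: bounded_linear_operator_def)

lemma T_add: "f \<in> E \<Longrightarrow> g \<in> E \<Longrightarrow> AE y in N. T (\<lambda>x. f x + g x) y = T f y + T g y"
  using bounded by (simp add: bounded_linear_operator_def)

lemma operator_norm_nonneg: "0 \<le> operator_norm E nE nF T"
  and operator_norm_bound: "f \<in> E \<Longrightarrow> nF (T f) \<le> operator_norm E nE nF T * nE f"
proof -
  obtain C where C: "\<And>f. f \<in> E \<Longrightarrow> nF (T f) \<le> C * nE f"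
    using bounded unfolding bounded_linear_operator_def by blast
  have C': "nF (T f) \<le> max 0 C * nE f" if "f \<in> E" for f
    using C[OF that] mult_right_mono[OF max.cobounded2 dom.nE_nonneg[OF that], of C 0] by linarith
  have eq: "operator_norm E nE nF T = Inf {C. 0 \<le> C \<and> (\<forall>f. f \<in> E \<longrightarrow> nF (T f) \<le> C * nE f)}"
    by (simp add: operator_norm_def Ball_def)
  note attained = Inf_bound_attained[where P = "\<lambda>f. f \<in> E" and m = 0 and C = "max 0 C"
      and h = "\<lambda>f. nF (T f)" and g = nE, folded eq]
  show "0 \<le> operator_norm E nE nF T" by (rule attained(1)) (use C' dom.nE_nonneg in auto)
  show "nF (T f) \<le> operator_norm E nE nF T * nE f" if "f \<in> E"
    by (rule attained(2)) (use C' dom.nE_nonneg that in auto)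
qed

lemma filtration_mono: "\<alpha> \<in> Q \<Longrightarrow> \<beta> \<in> Q \<Longrightarrow> \<alpha> \<le> \<beta> \<Longrightarrow> A \<alpha> \<subseteq> A \<beta>"
  using filtered by (cases "\<alpha> = \<beta>") (auto simp: filtration_def)

lemma filtration_sets: "\<alpha> \<in> Q \<Longrightarrow> A \<alpha> \<inter> space M \<in> sets M" "\<alpha> \<in> Q \<Longrightarrow> - A \<alpha> \<inter> space M \<in> sets M"
  using filtered by (auto simp: filtration_def Compl_eq_Diff_UNIV Diff_Int_distrib2)

text \<open>
  Inserting \<open>0\<close> gives the empty family the value \<open>0\<close> and does not affect any other family, the norms
  being nonnegative.
\<close>

definition finite_maximal :: "'i set \<Rightarrow> ('a \<Rightarrow> 'k) \<Rightarrow> 'b \<Rightarrow> real" where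
  "finite_maximal S f y = Max (insert 0 ((\<lambda>\<alpha>. norm (T (\<lambda>x. indicator (A \<alpha>) x * f x) y)) ` S))"

lemma finite_maximal_empty [simp]: "finite_maximal {} f y = 0"
  by (simp add: finite_maximal_def)

lemma finite_maximal_nonneg: "finite S \<Longrightarrow> 0 \<le> finite_maximal S f y"
  by (simp add: finite_maximal_def)

lemma finite_maximal_upper:
  "finite S \<Longrightarrow> \<alpha> \<in> S \<Longrightarrow> norm (T (\<lambda>x. indicator (A \<alpha>) x * f x) y) \<le> finite_maximal S f y"
  by (simp add: finite_maximal_def)

lemma finite_maximal_least:
  "finite S \<Longrightarrow> 0 \<le> c \<Longrightarrow> (\<And>\<alpha>. \<alpha> \<in> S \<Longrightarrow> norm (T (\<lambda>x. indicator (A \<alpha>) x * f x) y) \<le> c) \<Longrightarrow>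
    finite_maximal S f y \<le> c"
  by (simp add: finite_maximal_def)

text \<open>
  A family of sets inside \<open>B\<close> does not see the values of \<open>f\<close> off \<open>B\<close>.  This is what lets the induction
  hypothesis profit from the smallness of a part of \<open>f\<close>.
\<close>

lemma finite_maximal_restrict:
  assumes "\<And>\<alpha>. \<alpha> \<in> S \<Longrightarrow> A \<alpha> \<subseteq> B"
  shows "finite_maximal S (\<lambda>x. indicator B x * f x) = finite_maximal S f"
proof -
  have "(\<lambda>x. indicator (A \<alpha>) x * (indicator B x * f x)) = (\<lambda>x. indicator (A \<alpha>) x * f x)"
    if "\<alpha> \<in> S" for \<alpha>
    using assms[OF that] by (auto intro!: ext simp: indicator_def)
  then have "(\<lambda>\<alpha>. norm (T (\<lambda>x. indicator (A \<alpha>) x * (indicator B x * f x)) y)) ` S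
      = (\<lambda>\<alpha>. norm (T (\<lambda>x. indicator (A \<alpha>) x * f x) y)) ` S" for y
    by (intro image_cong) simp_all
  then show ?thesis by (intro ext) (simp only: finite_maximal_def)
qed

lemma finite_maximal_mem:
  assumes "finite S" "S \<subseteq> Q" "f \<in> E"
  shows "(\<lambda>y. of_real (finite_maximal S f y)) \<in> F"
  using assms(1,2)
proof (induction S rule: finite_induct)
  case empty
  then show ?case using cod.zero_mem by simp
next
  case (insert \<alpha> S)
  let ?h = "\<lambda>y. norm (T (\<lambda>x. indicator (A \<alpha>) x * f x) y)"
  have h: "(\<lambda>y. of_real (?h y)) \<in> F"
    using insert.prems assms(3) by (intro cod.modulus_mem T_mem dom.restrict_mem filtration_sets) auto
  have S: "(\<lambda>y. of_real (finite_maximal S f y)) \<in> F" using insert by simp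
  have eq: "finite_maximal (insert \<alpha> S) f y = max (?h y) (finite_maximal S f y)" for y
    unfolding finite_maximal_def image_insert
    by (subst insert_commute, rule Max_insert) (use insert.hyps in auto)
  have [measurable]: "?h \<in> borel_measurable N" "finite_maximal S f \<in> borel_measurable N"
    using h S insert.hyps by (auto intro!: cod.of_real_measurableD finite_maximal_nonneg)
  have "(\<lambda>y. of_real (max (?h y) (finite_maximal S f y)) :: 'k) \<in> borel_measurable N"
    by (intro cod.of_real_measurable) measurable
  moreover have "AE y in N. norm (of_real (max (?h y) (finite_maximal S f y)) :: 'k)
      \<le> norm (of_real (?h y) + of_real (finite_maximal S f y) :: 'k)"
  proof (rule AE_I2)
    fix y
    have "0 \<le> finite_maximal S f y" using insert.hyps by (simp add: finite_maximal_nonneg)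
    then have "\<bar>max (?h y) (finite_maximal S f y)\<bar> \<le> \<bar>?h y + finite_maximal S f y\<bar>"
      using norm_ge_zero[of "T (\<lambda>x. indicator (A \<alpha>) x * f x) y"] by linarith
    then show "norm (of_real (max (?h y) (finite_maximal S f y)) :: 'k)
        \<le> norm (of_real (?h y) + of_real (finite_maximal S f y) :: 'k)"
      by (simp only: norm_of_real flip: of_real_add)
  qed
  ultimately show ?case unfolding eq
    using cod.lattice[OF cod.add_mem[OF h S]] by blast
qed

text \<open>
  For \<open>k < \<alpha>\<close> the set \<open>A \<alpha>\<close> contains \<open>A k\<close>, so \<open>f \<chi>\<^bsub>A \<alpha>\<^esub>\<close> is the sum of \<open>f \<chi>\<^bsub>A k\<^esub>\<close> and of the
  restriction to \<open>A \<alpha>\<close> of the remainder of \<open>f\<close> off \<open>A k\<close>.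
\<close>

lemma finite_maximal_split:
  assumes S: "finite S" "S \<subseteq> Q" and k: "k \<in> S" and f: "f \<in> E"
  shows "AE y in N. finite_maximal S f y \<le> max (finite_maximal {\<alpha> \<in> S. \<alpha> < k} f y)
    (norm (T (\<lambda>x. indicator (A k) x * f x) y) +
      finite_maximal {\<alpha> \<in> S. k < \<alpha>} (\<lambda>x. indicator (- A k) x * f x) y)"
    (is "AE y in N. _ \<le> max (?g1 y) (?g2 y)")
proof -
  let ?f3 = "\<lambda>x. indicator (- A k) x * f x"
  have kQ: "k \<in> Q" using S k by blast
  have "AE y in N. \<forall>\<alpha>\<in>{\<alpha> \<in> S. k < \<alpha>}. T (\<lambda>x. indicator (A \<alpha>) x * f x) y =
      T (\<lambda>x. indicator (A k) x * f x) y + T (\<lambda>x. indicator (A \<alpha>) x * ?f3 x) y"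
  proof (rule AE_finite_allI)
    fix \<alpha> assume \<alpha>: "\<alpha> \<in> {\<alpha> \<in> S. k < \<alpha>}"
    then have \<alpha>Q: "\<alpha> \<in> Q" using S by blast
    have sub: "A k \<subseteq> A \<alpha>" using \<alpha> \<alpha>Q kQ by (intro filtration_mono) auto
    have "(\<lambda>x. indicator (A \<alpha>) x * f x) =
        (\<lambda>x. indicator (A k) x * f x + indicator (A \<alpha>) x * ?f3 x)"
      using sub by (auto intro!: ext simp: indicator_def)
    moreover have "AE y in N. T (\<lambda>x. indicator (A k) x * f x + indicator (A \<alpha>) x * ?f3 x) y =
      T (\<lambda>x. indicator (A k) x * f x) y + T (\<lambda>x. indicator (A \<alpha>) x * ?f3 x) y"
      using f kQ \<alpha>Q by (intro T_add dom.restrict_mem filtration_sets) auto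
    ultimately show "AE y in N. T (\<lambda>x. indicator (A \<alpha>) x * f x) y =
      T (\<lambda>x. indicator (A k) x * f x) y + T (\<lambda>x. indicator (A \<alpha>) x * ?f3 x) y" by simp
  qed (use S in simp)
  then show ?thesis
  proof eventually_elim
    case (elim y)
    have g1: "0 \<le> ?g1 y" and g3: "0 \<le> finite_maximal {\<alpha> \<in> S. k < \<alpha>} ?f3 y"
      using S by (auto intro: finite_maximal_nonneg)
    show ?case
    proof (rule finite_maximal_least[OF S(1)])
      show "0 \<le> max (?g1 y) (?g2 y)" using g1 by simp
      fix \<alpha> assume \<alpha>: "\<alpha> \<in> S"
      consider "\<alpha> < k" | "\<alpha> = k" | "k < \<alpha>" by fastforce
      then show "norm (T (\<lambda>x. indicator (A \<alpha>) x * f x) y) \<le> max (?g1 y) (?g2 y)"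
      proof cases
        case 1
        then have "norm (T (\<lambda>x. indicator (A \<alpha>) x * f x) y) \<le> ?g1 y"
          using S \<alpha> by (intro finite_maximal_upper) auto
        then show ?thesis by simp
      next
        case 2
        then show ?thesis using g3 by simp
      next
        case 3
        then have "norm (T (\<lambda>x. indicator (A \<alpha>) x * ?f3 x) y) \<le> finite_maximal {\<alpha> \<in> S. k < \<alpha>} ?f3 y"
          using S \<alpha> by (intro finite_maximal_upper) auto
        then have "norm (T (\<lambda>x. indicator (A \<alpha>) x * f x) y) \<le> ?g2 y"
          using elim 3 \<alpha> norm_triangle_mono by fastforce
        then show ?thesis by simp
      qed
    qed
  qed
qed

text \<open>
  The inductive heart of the proof.  The indices before \<open>k\<close> contribute at most
  \<open>\<gamma> t a \<parallel>f\<parallel>\<close>, the index \<open>k\<close> and those after it at most \<open>\<kappa> (1 + \<gamma> b) t \<parallel>f\<parallel>\<close>; the hypothesis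
  \<open>balance\<close> makes these two numbers comparable, and \<open>ua\<close> says that the upper estimate then returns
  exactly \<open>\<gamma> t \<parallel>f\<parallel>\<close>.
\<close>

lemma norm_finite_maximal_le:
  fixes p a b K \<gamma> :: real and q :: ennreal
  defines "t \<equiv> operator_norm E nE nF T" and "u \<equiv> upper_const N F nF q 2"
    and "l \<equiv> lower_const M E nE (ennreal p) 2" and "\<kappa> \<equiv> triangle_const F nF"
  assumes p: "0 < p" and q: "0 < q" and K: "0 < K" and a: "0 < a" and \<gamma>: "0 \<le> \<gamma>"
    and b: "b = (l powr p - a powr p) powr (1 / p)"
    and ua: "u * a * (1 + K) powr recip q = 1"
    and balance: "\<kappa> * (1 + \<gamma> * b) = \<gamma> * a * K powr recip q"
    and S: "finite S" "S \<subseteq> Q" and f: "f \<in> E"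
  shows "nF (\<lambda>y. of_real (finite_maximal S f y)) \<le> \<gamma> * t * nE f"
  using S f
proof (induction "card S" arbitrary: S f rule: less_induct)
  case less
  note S = less.prems(1,2) and f = less.prems(3)
  have t: "0 \<le> t" unfolding t_def by (rule operator_norm_nonneg)
  have n: "0 \<le> nE f" by (rule dom.nE_nonneg[OF f])
  have b0: "0 \<le> b" using b by simp
  have F0: "nF (\<lambda>_. 0) = 0" using cod.nE_eq_0_iff[OF cod.zero_mem] by simp
  show ?case
  proof (cases "S = {}")
    case True
    then show ?thesis using F0 \<gamma> t n by simp
  next
    case False
    \<comment> \<open>If no index is large, the cut is made at the last one: then nothing comes after it, and there is
      no remainder to estimate.\<close>
    define U where "U = {\<alpha> \<in> S. a * nE f < nE (\<lambda>x. indicator (A \<alpha>) x * f x)}"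
    define k where "k = (if U = {} then Max S else Min U)"
    let ?S1 = "{\<alpha> \<in> S. \<alpha> < k}" and ?S3 = "{\<alpha> \<in> S. k < \<alpha>}"
    let ?f2 = "\<lambda>x. indicator (A k) x * f x" and ?f3 = "\<lambda>x. indicator (- A k) x * f x"
    have U: "finite U" "U \<subseteq> S" unfolding U_def using S by auto
    have k: "k \<in> S" using Max_in[OF S(1) False] Min_in[OF U(1)] U(2) unfolding k_def by auto
    then have kQ: "k \<in> Q" using S by blast
    have small: "nE (\<lambda>x. indicator (A \<alpha>) x * f x) \<le> a * nE f" if "\<alpha> \<in> ?S1" for \<alpha>
    proof -
      have "\<alpha> \<notin> U" using that U Min_le[of U \<alpha>] by (auto simp: k_def split: if_splits)
      then show ?thesis using that by (simp add: U_def)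
    qed
    have fin: "finite ?S1" "finite ?S3" using S by auto
    have sub: "?S1 \<subseteq> Q" "?S3 \<subseteq> Q" using S by auto
    have card: "card ?S1 < card S" "card ?S3 < card S"
      using S k by (auto intro!: psubset_card_mono)
    have f2: "?f2 \<in> E" "nE ?f2 \<le> nE f" and f3: "?f3 \<in> E" "nE ?f3 \<le> nE f"
      using dom.restrict_mem[OF f] filtration_sets[OF kQ] by auto

    have head: "nF (\<lambda>y. of_real (finite_maximal ?S1 f y)) \<le> \<gamma> * t * (a * nE f)"
    proof (cases "?S1 = {}")
      case True
      show ?thesis unfolding True using F0 \<gamma> t a n by simp
    next
      case False
      define m where "m = Max ?S1"
      have m: "m \<in> ?S1" unfolding m_def using fin False by (intro Max_in)
      then have mQ: "m \<in> Q" using sub by blast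
      have "A \<alpha> \<subseteq> A m" if "\<alpha> \<in> ?S1" for \<alpha>
        using that sub mQ fin by (intro filtration_mono) (auto simp: m_def)
      then have "finite_maximal ?S1 f = finite_maximal ?S1 (\<lambda>x. indicator (A m) x * f x)"
        by (rule finite_maximal_restrict[symmetric])
      moreover have "nF (\<lambda>y. of_real (finite_maximal ?S1 (\<lambda>x. indicator (A m) x * f x) y))
          \<le> \<gamma> * t * nE (\<lambda>x. indicator (A m) x * f x)"
        using less.hyps[OF card(1) fin(1) sub(1)] dom.restrict_mem[OF f filtration_sets(1)[OF mQ]]
        by blast
      moreover have "\<gamma> * t * nE (\<lambda>x. indicator (A m) x * f x) \<le> \<gamma> * t * (a * nE f)"
        using small[OF m] \<gamma> t by (intro mult_left_mono) auto
      ultimately show ?thesis by simp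
    qed

    have tail: "nF (\<lambda>y. of_real (finite_maximal ?S3 ?f3 y)) \<le> \<gamma> * t * (b * nE f)"
    proof (cases "?S3 = {}")
      case True
      show ?thesis unfolding True using F0 \<gamma> t b0 n by simp
    next
      case False
      then have "U \<noteq> {}" using S by (auto simp: k_def not_less)
      then have "k \<in> U" using Min_in[OF U(1)] by (simp add: k_def)
      then have large: "a * nE f < nE ?f2" by (simp add: U_def)
      define x where "x = (\<lambda>j::nat. if j = 1 then ?f2 else ?f3)"
      have x: "x 1 = ?f2" "x (Suc 0) = ?f2" "x 2 = ?f3" by (simp_all add: x_def)
      have "p_sum (ennreal p) 2 (\<lambda>j. nE (x j)) \<le> l * nE (\<lambda>t. x 1 t + x 2 t)"
        unfolding l_def
        by (rule dom.lower_const_bound) (use p f2 f3 in \<open>auto simp: x indicator_def\<close>)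
      moreover have "(\<lambda>t. x 1 t + x 2 t) = f" by (auto simp: x indicator_def)
      ultimately have "(nE ?f2 powr p + nE ?f3 powr p) powr (1 / p) \<le> l * nE f"
        using p by (simp add: p_sum_2 x)
      moreover have "0 \<le> l" unfolding l_def using p by (intro dom.lower_const_nonneg) simp
      ultimately have "nE ?f3 \<le> b * nE f"
        unfolding b using p a n dom.nE_nonneg[OF f3(1)] f3(2) large
        by (intro remainder_bound[where t = "nE ?f2"]) auto
      then have "\<gamma> * t * nE ?f3 \<le> \<gamma> * t * (b * nE f)"
        using \<gamma> t by (intro mult_left_mono) auto
      with less.hyps[OF card(2) fin(2) sub(2) f3(1)] show ?thesis by linarith
    qed

    define g1 where "g1 = finite_maximal ?S1 f"
    define g2 where "g2 = (\<lambda>y. norm (T ?f2 y) + finite_maximal ?S3 ?f3 y)"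
    have g0: "0 \<le> g1 y" "0 \<le> g2 y" for y
      using fin by (auto simp: g1_def g2_def finite_maximal_nonneg)
    have F1: "(\<lambda>y. of_real (g1 y)) \<in> F"
      unfolding g1_def by (rule finite_maximal_mem[OF fin(1) sub(1) f])
    have F3: "(\<lambda>y. of_real (finite_maximal ?S3 ?f3 y)) \<in> F"
      by (rule finite_maximal_mem[OF fin(2) sub(2) f3(1)])
    note Tf2 = cod.modulus_mem[OF T_mem[OF f2(1)]]
    have F2: "(\<lambda>y. of_real (g2 y)) \<in> F"
      unfolding g2_def of_real_add by (rule cod.add_mem[OF Tf2(1) F3])
    have "nF (\<lambda>y. of_real (g2 y)) \<le>
        \<kappa> * (nF (\<lambda>y. of_real (norm (T ?f2 y))) + nF (\<lambda>y. of_real (finite_maximal ?S3 ?f3 y)))"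
      unfolding g2_def of_real_add \<kappa>_def by (rule cod.quasi_triangle[OF Tf2(1) F3])
    also have "\<dots> \<le> \<kappa> * (t * nE f + \<gamma> * t * (b * nE f))"
    proof (intro mult_left_mono add_mono tail)
      have "nF (T ?f2) \<le> t * nE ?f2" unfolding t_def by (rule operator_norm_bound[OF f2(1)])
      also have "\<dots> \<le> t * nE f" using f2(2) t by (rule mult_left_mono)
      finally show "nF (\<lambda>y. of_real (norm (T ?f2 y))) \<le> t * nE f" using Tf2(2) by simp
      show "0 \<le> \<kappa>" unfolding \<kappa>_def using cod.triangle_const_ge_1 by simp
    qed
    also have "\<dots> = t * nE f * (\<kappa> * (1 + \<gamma> * b))" by (simp add: algebra_simps)
    also have "\<dots> = \<gamma> * t * (a * nE f) * K powr recip q" unfolding balance by simp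
    finally have G2: "nF (\<lambda>y. of_real (g2 y)) \<le> \<gamma> * t * (a * nE f) * K powr recip q" .

    have [measurable]: "g1 \<in> borel_measurable N" "g2 \<in> borel_measurable N"
      using cod.of_real_measurableD[OF F1] cod.of_real_measurableD[OF F2] g0 by auto
    \<comment> \<open>Realise the maximum of \<open>g1\<close> and \<open>g2\<close> as a sum of two disjointly supported functions.\<close>
    define B where "B = {y \<in> space N. g2 y \<le> g1 y}"
    have [measurable]: "B \<in> sets N" unfolding B_def by measurable
    define x where "x = (\<lambda>j::nat. if j = 1 then (\<lambda>y. indicator B y * of_real (g1 y) :: 'k)
      else (\<lambda>y. indicator (- B) y * of_real (g2 y)))"
    have x: "x 1 = (\<lambda>y. indicator B y * of_real (g1 y))"
      "x (Suc 0) = (\<lambda>y. indicator B y * of_real (g1 y))"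
      "x 2 = (\<lambda>y. indicator (- B) y * of_real (g2 y))" by (simp_all add: x_def)
    have B: "B \<inter> space N \<in> sets N" "- B \<inter> space N \<in> sets N"
      by (auto simp: Compl_eq_Diff_UNIV Diff_Int_distrib2)
    have xF: "x 1 \<in> F" "x 2 \<in> F" and xn: "nF (x 1) \<le> nF (\<lambda>y. of_real (g1 y))"
      "nF (x 2) \<le> nF (\<lambda>y. of_real (g2 y))"
      using cod.restrict_mem[OF F1 B(1)] cod.restrict_mem[OF F2 B(2)] by (auto simp: x)
    have "AE y in N. y \<in> space N" by simp
    with finite_maximal_split[OF S k f]
    have "AE y in N. norm (of_real (finite_maximal S f y) :: 'k) \<le> norm (x 1 y + x 2 y)"
    proof eventually_elim
      case (elim y)
      have "x 1 y + x 2 y = of_real (max (g1 y) (g2 y))"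
        using elim by (simp add: x B_def indicator_def max_def)
      then show ?case
        using elim g0[of y] finite_maximal_nonneg[OF S(1), of f y] by (simp add: g1_def g2_def)
    qed
    then have "nF (\<lambda>y. of_real (finite_maximal S f y)) \<le> nF (\<lambda>y. x 1 y + x 2 y)"
      using cod.lattice[OF cod.add_mem[OF xF]]
        cod.measurable_mem[OF finite_maximal_mem[OF S f]] by blast
    also have "\<dots> \<le> u * p_sum q 2 (\<lambda>j. nF (x j))"
      unfolding u_def
      by (rule cod.upper_const_bound[OF q xF]) (auto simp: x indicator_def)
    also have "\<dots> \<le> u * (\<gamma> * t * (a * nE f) * (1 + K) powr recip q)"
    proof (intro mult_left_mono p_sum_2_weighted[OF q])
      show "0 \<le> u" unfolding u_def by (rule cod.upper_const_nonneg[OF q])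
      show "0 \<le> nF (x 1)" "0 \<le> nF (x 2)" using xF cod.nE_nonneg by auto
      show "0 \<le> \<gamma> * t * (a * nE f)" using \<gamma> t a n by simp
      show "nF (x 1) \<le> \<gamma> * t * (a * nE f)" using xn(1) head by (simp add: g1_def)
      show "nF (x 2) \<le> \<gamma> * t * (a * nE f) * K powr recip q" using xn(2) G2 by simp
    qed (rule K)
    also have "\<dots> = \<gamma> * t * nE f * (u * a * (1 + K) powr recip q)" by (simp add: algebra_simps)
    also have "\<dots> = \<gamma> * t * nE f" unfolding ua by simp
    finally show ?thesis .
  qed
qed

section \<open>The whole filtration\<close>

text \<open>
  An enumeration of the countable index set exhausts it by finite subfamilies, along which the maximal
  functions increase.
\<close>

lemma extended_norm_maximal_operator_le:
  assumes fatou: "fatou_property N F nF" and f: "f \<in> E"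
    and bound: "\<And>S. finite S \<Longrightarrow> S \<subseteq> Q \<Longrightarrow> nF (\<lambda>y. of_real (finite_maximal S f y)) \<le> C"
  shows "extended_quasi_norm N F nF (maximal_operator Q A T f) \<le> ennreal C"
proof -
  have Q: "countable Q" using filtered by (simp add: filtration_def)
  define S where "S n = {\<alpha> \<in> Q. to_nat_on Q \<alpha> < n}" for n
  have "finite (to_nat_on Q ` S n)" for n
    by (rule finite_subset[of _ "{..<n}"]) (auto simp: S_def)
  moreover have "inj_on (to_nat_on Q) (S n)" for n
    by (rule inj_on_subset[OF inj_on_to_nat_on[OF Q]]) (auto simp: S_def)
  ultimately have fin: "finite (S n)" for n by (rule finite_imageD)
  have sub: "S n \<subseteq> Q" for n by (auto simp: S_def)
  have mono: "incseq (\<lambda>n. finite_maximal (S n) f y)" for y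
  proof (rule incseq_SucI)
    fix n
    show "finite_maximal (S n) f y \<le> finite_maximal (S (Suc n)) f y"
      by (intro finite_maximal_least finite_maximal_upper finite_maximal_nonneg fin)
        (auto simp: S_def)
  qed
  have "maximal_operator Q A T f y = (SUP n. ennreal (finite_maximal (S n) f y))" for y
  proof (rule antisym)
    show "maximal_operator Q A T f y \<le> (SUP n. ennreal (finite_maximal (S n) f y))"
      unfolding maximal_operator_def
    proof (rule SUP_least)
      fix \<alpha> assume "\<alpha> \<in> Q"
      then have "\<alpha> \<in> S (Suc (to_nat_on Q \<alpha>))" by (simp add: S_def)
      then show "ennreal (norm (T (\<lambda>x. indicator (A \<alpha>) x * f x) y))
          \<le> (SUP n. ennreal (finite_maximal (S n) f y))"
        by (intro SUP_upper2 ennreal_leI finite_maximal_upper fin) auto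
    qed
    show "(SUP n. ennreal (finite_maximal (S n) f y)) \<le> maximal_operator Q A T f y"
    proof (rule SUP_least)
      fix n
      have "finite_maximal (S n) f y \<in> insert 0 ((\<lambda>\<alpha>. norm (T (\<lambda>x. indicator (A \<alpha>) x * f x) y)) ` S n)"
        unfolding finite_maximal_def using fin by (intro Max_in) auto
      then show "ennreal (finite_maximal (S n) f y) \<le> maximal_operator Q A T f y"
        unfolding maximal_operator_def using sub[of n] by (auto intro: SUP_upper2)
    qed
  qed
  then have "maximal_operator Q A T f = (\<lambda>y. SUP n. ennreal (finite_maximal (S n) f y))" by blast
  moreover have "extended_quasi_norm N F nF (\<lambda>y. SUP n. ennreal (finite_maximal (S n) f y)) \<le> ennreal C"
    by (intro cod.fatou_extended fatou finite_maximal_mem finite_maximal_nonneg mono bound fin sub f)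
  ultimately show ?thesis by simp
qed

text \<open>
  This covers the case in which \<open>T\<close> vanishes.  There the constants \<open>l\<close> and \<open>u\<close> may be \<open>0\<close>, and
  the formula for \<open>\<gamma>\<close> carries no information.
\<close>

lemma finite_maximal_null:
  assumes null: "\<And>f. f \<in> E \<Longrightarrow> nF (T f) = 0" and S: "finite S" "S \<subseteq> Q" and f: "f \<in> E"
  shows "nF (\<lambda>y. of_real (finite_maximal S f y)) = 0"
proof -
  have "AE y in N. \<forall>\<alpha>\<in>S. T (\<lambda>x. indicator (A \<alpha>) x * f x) y = 0"
  proof (rule AE_finite_allI[OF S(1)])
    fix \<alpha> assume "\<alpha> \<in> S"
    then have "(\<lambda>x. indicator (A \<alpha>) x * f x) \<in> E"
      using S f by (intro dom.restrict_mem filtration_sets) auto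
    then show "AE y in N. T (\<lambda>x. indicator (A \<alpha>) x * f x) y = 0"
      using null cod.nE_eq_0_iff T_mem by blast
  qed
  then have "AE y in N. (of_real (finite_maximal S f y) :: 'k) = 0"
  proof eventually_elim
    case (elim y)
    have "finite_maximal S f y \<le> 0" by (rule finite_maximal_least) (use S elim in auto)
    then show ?case using finite_maximal_nonneg[OF S(1), of f y] by simp
  qed
  then show ?thesis using cod.nE_eq_0_iff finite_maximal_mem[OF S f] by blast
qed

lemma extended_operator_norm_le:
  assumes fatou: "fatou_property N F nF" and C: "0 \<le> C"
    and bound: "\<And>S f. finite S \<Longrightarrow> S \<subseteq> Q \<Longrightarrow> f \<in> E \<Longrightarrow>
      nF (\<lambda>y. of_real (finite_maximal S f y)) \<le> C * nE f"
  shows "extended_operator_norm E nE N F nF (maximal_operator Q A T) \<le> ennreal C"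
  unfolding extended_operator_norm_def
proof (rule Inf_lower, intro CollectI ballI)
  fix f assume f: "f \<in> E"
  have "extended_quasi_norm N F nF (maximal_operator Q A T f) \<le> ennreal (C * nE f)"
    by (intro extended_norm_maximal_operator_le fatou f bound)
  then show "extended_quasi_norm N F nF (maximal_operator Q A T f) \<le> ennreal C * ennreal (nE f)"
    using C dom.nE_nonneg[OF f] by (simp add: ennreal_mult)
qed

end

section \<open>The maximal inequality\<close>

theorem theorem3p1:
  fixes M :: "'a measure" and N :: "'b measure"
    and E :: "('a \<Rightarrow> 'k::{real_normed_field, euclidean_space}) set" and nE :: "('a \<Rightarrow> 'k) \<Rightarrow> real"
    and F :: "('b \<Rightarrow> 'k) set" and nF :: "('b \<Rightarrow> 'k) \<Rightarrow> real"
    and T :: "('a \<Rightarrow> 'k) \<Rightarrow> 'b \<Rightarrow> 'k"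
    and Q :: "'i::linorder set" and A :: "'i \<Rightarrow> 'a set"
    and p \<tau> \<kappa> l u \<gamma> :: real and q :: ennreal
  assumes "quasi_banach_function_lattice M E nE"
    and "quasi_banach_function_lattice N F nF"
    and "bounded_linear_operator M E nE N F nF T"
    and "\<kappa> = triangle_const F nF"
    and "filtration M Q A"
    and "fatou_property N F nF"
    and "0 < p" and "ennreal p < q"
    and "1 / \<tau> = 1 / p - recip q"
    and "l = lower_const M E nE (ennreal p) 2"
    and "u = upper_const N F nF q 2"
    and "l * u < (1 + \<kappa> powr (- \<tau>)) powr (1 / \<tau>)"
    and "\<gamma> = u * (1 + \<kappa> powr (- \<tau>)) powr recip q /
               (\<kappa> powr (- \<tau> / p) -
                 (l powr p * u powr p * (1 + \<kappa> powr (- \<tau>)) powr (p * recip q) - 1) powr (1 / p))"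
  shows "extended_operator_norm E nE N F nF (maximal_operator Q A T)
           \<le> ennreal (\<gamma> * operator_norm E nE nF T) \<and>
         (triangle_inequality_on F nF \<longrightarrow>
           \<gamma> = u * 2 powr recip q /
               (1 - (l powr p * u powr p * 2 powr (p * recip q) - 1) powr (1 / p)))"
proof (intro conjI impI)
  interpret filtered_operator M E nE N F nF T Q A
    using assms(1-3,5) by (intro filtered_operator.intro filtered_operator_axioms.intro)
  let ?t = "operator_norm E nE nF T"
  note p = \<open>0 < p\<close> and pq = \<open>ennreal p < q\<close> and \<tau> = \<open>1 / \<tau> = 1 / p - recip q\<close>
  have q: "0 < q" using pq by (rule le_less_trans[rotated]) simp
  show "extended_operator_norm E nE N F nF (maximal_operator Q A T) \<le> ennreal (\<gamma> * ?t)"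
  proof (cases "\<forall>f\<in>E. nF (T f) = 0")
    case True
    have "extended_operator_norm E nE N F nF (maximal_operator Q A T) \<le> ennreal 0"
      by (rule extended_operator_norm_le) (use True assms(6) finite_maximal_null in auto)
    then show ?thesis by (simp add: order_trans[OF _ zero_le])
  next
    case False
    then obtain f where f: "f \<in> E" "nF (T f) \<noteq> 0" by blast
    \<comment> \<open>Both lattices contain a function of nonzero quasi-norm, so \<open>l\<close> and \<open>u\<close> are at least \<open>1\<close>.\<close>
    have "nE f \<noteq> 0"
      using operator_norm_bound[OF f(1)] cod.nE_nonneg[OF T_mem[OF f(1)]] f(2) by auto
    with f(1) p have l: "1 \<le> l" unfolding assms(10) by (intro dom.lower_const_ge_1) auto
    have u: "1 \<le> u" unfolding assms(11) using T_mem[OF f(1)] f(2) q by (rule cod.upper_const_ge_1)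
    have \<kappa>: "1 \<le> \<kappa>" unfolding assms(4) by (rule cod.triangle_const_ge_1)
    have r: "0 \<le> recip q" by (simp add: recip_def)
    have "recip q < 1 / p"
    proof (cases "q = \<infinity>")
      case True
      then show ?thesis using p by (simp add: recip_def)
    next
      case False
      have "p < enn2real q" using pq p False by (cases q) (auto simp: ennreal_less_iff)
      then show ?thesis using p by (simp add: recip_eq[OF q False] frac_less2)
    qed
    then have "0 < 1 / \<tau>" using \<tau> by simp
    then have \<tau>0: "0 < \<tau>" by simp
    define K where "K = \<kappa> powr (- \<tau>)"
    define a where "a = 1 / (u * (1 + K) powr recip q)"
    define b where "b = (l powr p - a powr p) powr (1 / p)"
    note constants = Christ_Kiselev_constants[OF p \<tau>0 \<tau> \<kappa> l u r assms(12,13) a_def[unfolded K_def] b_def,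
        folded K_def]
    have "nF (\<lambda>y. of_real (finite_maximal S f y)) \<le> \<gamma> * ?t * nE f"
      if "finite S" "S \<subseteq> Q" "f \<in> E" for S f
    proof (rule norm_finite_maximal_le[OF p q])
      show "0 < K" unfolding K_def using \<kappa> by simp
    qed (use constants b_def that assms(4,10,11) in simp_all)
    then show ?thesis
      using constants(2) operator_norm_nonneg assms(6) by (intro extended_operator_norm_le) auto
  qed
  assume "triangle_inequality_on F nF"
  then have "\<kappa> = 1" unfolding assms(4) by (rule cod.triangle_const_eq_1)
  then show "\<gamma> = u * 2 powr recip q /
      (1 - (l powr p * u powr p * 2 powr (p * recip q) - 1) powr (1 / p))"
    unfolding assms(13) by simp
qed

end
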